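(* Let $n \in \mathbb{N}$ and let $U_n(z) := \sum_{k \in \mathbb{Z}} \frac{1}{k^n + z^n}$. At $z = e^{i\theta}$, the real and imaginary parts of $U_n(e^{i\theta})$ are given by $$\operatorname{Re}(U_n(e^{i\theta})) = \sum_{k=-\infty}^{\infty} \frac{k^n + \cos(n\theta)}{k^{2n} + 2k^n \cos(n\theta) + 1},$$ $$\operatorname{Im}(U_n(e^{i\theta})) = -\sum_{k=-\infty}^{\infty} \frac{\sin(n\theta)}{k^{2n} + 2k^n \cos(n\theta) + 1}.$$ Moreover, $$\operatorname{Re}(U_n(e^{i\theta})) + \cot(n\theta) \cdot \operatorname{Im}(U_n(e^{i\theta})) = \sum_{k=-\infty}^{\infty} \frac{k^n}{k^{2n} + 2k^n \cos(n\theta) + 1}.$$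
   Context: $\mathbb{N}$ denotes the positive integers and $\theta$ is a real angle, so that $z=e^{i\theta}$ lies on the unit circle. *)

theory Defs
  imports "HOL-Analysis.Analysis"
begin

text \<open>
  A series over all integers is summed symmetrically, as the limit of the partial sums over
  \<open>- N \<le> k \<le> N\<close>.  This convention is needed only for \<open>n = 1\<close>, where the series
  \<open>\<Sum>k. 1 / (k + z)\<close> does not converge unconditionally; lemma \<open>has_sum_imp_bilateral_sums\<close>
  shows that it agrees with unconditional summation whenever the latter is possible.
\<close>

definition bilateral_sums :: "(int \<Rightarrow> 'a::{topological_space, comm_monoid_add}) \<Rightarrow> 'a \<Rightarrow> bool"
    (infixr \<open>bilateral'_sums\<close> 80) where
  "f bilateral_sums s \<longleftrightarrow> (\<lambda>N. \<Sum>k = - int N..int N. f k) \<longlonglongrightarrow> s"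

definition bilateral_suminf :: "(int \<Rightarrow> 'a::{topological_space, comm_monoid_add}) \<Rightarrow> 'a" where
  "bilateral_suminf f = (THE s. f bilateral_sums s)"

definition U :: "nat \<Rightarrow> complex \<Rightarrow> complex" where
  "U n z = bilateral_suminf (\<lambda>k. 1 / (of_int k ^ n + z ^ n))"

lemma bilateral_suminf_eqI:
  fixes f :: "int \<Rightarrow> 'a::{t2_space, comm_monoid_add}"
  assumes "f bilateral_sums s"
  shows "bilateral_suminf f = s"
  using assms unfolding bilateral_suminf_def bilateral_sums_def
  by (intro the_equality) (auto intro: LIMSEQ_unique)

lemma has_sum_imp_bilateral_sums:
  fixes f :: "int \<Rightarrow> 'a::{topological_space, comm_monoid_add}"
  assumes "(f has_sum s) UNIV"
  shows "f bilateral_sums s"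
proof -
  have "filterlim (\<lambda>N. {- int N..int N}) (finite_subsets_at_top UNIV) sequentially"
    unfolding filterlim_finite_subsets_at_top
  proof (intro allI impI)
    fix X :: "int set"
    assume "finite X \<and> X \<subseteq> UNIV"
    then have fin: "finite X" by simp
    obtain M where M: "\<And>k. k \<in> X \<Longrightarrow> nat \<bar>k\<bar> \<le> M"
      using finite_nat_set_iff_bounded_le[of "(\<lambda>k. nat \<bar>k\<bar>) ` X"] fin by auto
    have "X \<subseteq> {- int N..int N}" if "N \<ge> M" for N
      using M that by fastforce
    then show "\<forall>\<^sub>F N in sequentially. finite {- int N..int N} \<and> X \<subseteq> {- int N..int N} \<and>
        {- int N..int N} \<subseteq> UNIV"
      by (auto simp: eventually_sequentially)
  qed
  then show ?thesis
    using assms filterlim_compose unfolding has_sum_def bilateral_sums_def by blast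
qed

end

theory Submission
  imports Defs
begin

text \<open>
  Once \<open>U\<close> is known to converge, the formulas follow termwise from
  \<open>1 / (a + cis t) = (a + cis (- t)) / (a\<^sup>2 + 2 * a * cos t + 1)\<close>.  For convergence, pair the
  terms of index \<open>k\<close> and \<open>-k\<close>: with \<open>w = z ^ n\<close>, a pair adds up to \<open>2 / (k ^ n + w)\<close> for
  even \<open>n\<close> and to \<open>2 * w / (w\<^sup>2 - k ^ (2 * n))\<close> for odd \<open>n\<close>, which is \<open>O(1 / k\<^sup>2)\<close> in both cases.
\<close>

lemma sum_symmetric_int_interval:
  fixes f :: "int \<Rightarrow> 'a::comm_monoid_add"
  shows "(\<Sum>k = - int N..int N. f k) = f 0 + (\<Sum>k<N. f (int (Suc k)) + f (- int (Suc k)))"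
proof (induction N)
  case (Suc N)
  have "{- int (Suc N)..int (Suc N)} =
      insert (int (Suc N)) (insert (- int (Suc N)) {- int N..int N})"
    by auto
  then have "(\<Sum>k = - int (Suc N)..int (Suc N). f k) =
      f (int (Suc N)) + (f (- int (Suc N)) + (\<Sum>k = - int N..int N. f k))"
    by simp
  with Suc show ?case
    by (simp add: ac_simps)
qed simp

text \<open>Pairing \<open>k\<close> with \<open>-k\<close> turns symmetric partial sums into those
  of an ordinary series, where comparison tests apply; the index 0 has no partner and is split
  off.\<close>

lemma summable_imp_bilateral_sums:
  fixes f :: "int \<Rightarrow> 'a::real_normed_vector"
  assumes "summable (\<lambda>k. f (int (Suc k)) + f (- int (Suc k)))"
  shows "f bilateral_sums (f 0 + (\<Sum>k. f (int (Suc k)) + f (- int (Suc k))))"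
  unfolding bilateral_sums_def sum_symmetric_int_interval
  by (intro tendsto_add tendsto_const summable_LIMSEQ assms)

lemma norm_inverse_pair_le:
  fixes w :: complex and x :: real
  assumes "n \<ge> 1" and "norm w = 1" and "x \<ge> 2"
  shows "norm (1 / (of_real x ^ n + w) + 1 / (of_real (- x) ^ n + w)) \<le> 4 / x\<^sup>2"
proof -
  \<comment> \<open>One estimate serves both parities: \<open>u = 1\<close>, \<open>v = w\<close>,
    \<open>y = x ^ n\<close> for even \<open>n\<close>, and \<open>u = w\<close>,
    \<open>v = w\<^sup>2\<close>, \<open>y = - ((x ^ n)\<^sup>2)\<close> for odd
    \<open>n\<close>.\<close>
  have bound: "norm (2 * u / (v + of_real y)) \<le> 4 / x\<^sup>2"
    if "norm u = 1" "norm v = 1" "\<bar>y\<bar> \<ge> x\<^sup>2" for u v :: complex and y :: real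
  proof -
    have "x\<^sup>2 \<ge> 2\<^sup>2"
      using assms by (intro power_mono) auto
    moreover have "norm (v + of_real y) \<ge> \<bar>y\<bar> - 1"
      using norm_triangle_ineq2[of "of_real y" "- v"] that by (simp add: add.commute)
    \<comment> \<open>From \<open>x \<ge> 2\<close>, the 1 lost in the triangle inequality is at
      most half of \<open>x\<^sup>2\<close>; this halving makes the constant 4.\<close>
    ultimately have "norm (v + of_real y) \<ge> x\<^sup>2 / 2" "x\<^sup>2 > 0"
      using that by auto
    then have "2 / norm (v + of_real y) \<le> 2 / (x\<^sup>2 / 2)"
      by (intro divide_left_mono mult_pos_pos) auto
    then show ?thesis
      using that by (simp add: norm_divide norm_mult)
  qed
  show ?thesis
  proof (cases "even n")
    case True
    \<comment> \<open>An even \<open>n \<ge> 1\<close> is at least 2.\<close>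
    with assms have "x ^ 2 \<le> x ^ n"
      by (intro power_increasing) (auto elim!: evenE)
    then have "norm (2 * 1 / (w + of_real (x ^ n))) \<le> 4 / x\<^sup>2"
      using assms by (intro bound) auto
    with True show ?thesis
      by (simp add: add.commute)
  next
    case False
    have "x ^ 1 \<le> x ^ n"
      using assms by (intro power_increasing) auto
    then have "x ^ n > 1"
      using assms by simp
    have "norm (of_real x ^ n :: complex) = x ^ n"
      using assms by (simp add: norm_power)
    then have nz: "of_real x ^ n + w \<noteq> 0" "of_real x ^ n \<noteq> w"
      using \<open>x ^ n > 1\<close> assms(2) by (auto simp: add_eq_0_iff)
    \<comment> \<open>Here \<open>n\<close> may be 1, so a single term is only
      \<open>O(1 / x)\<close>; the square comes from the product of the two denominators.\<close>
    have "x\<^sup>2 \<le> (x ^ n)\<^sup>2"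
      using assms \<open>x ^ 1 \<le> x ^ n\<close> by (intro power_mono) auto
    then have "norm (2 * w / (w\<^sup>2 + of_real (- ((x ^ n)\<^sup>2)))) \<le> 4 / x\<^sup>2"
      using assms by (intro bound) (auto simp: norm_power)
    also have "2 * w / (w\<^sup>2 + of_real (- ((x ^ n)\<^sup>2))) =
        1 / (of_real x ^ n + w) + 1 / (of_real (- x) ^ n + w)"
    proof -
      have "w\<^sup>2 + of_real (- ((x ^ n)\<^sup>2)) = (of_real x ^ n + w) * (w - of_real x ^ n)"
        by (simp add: power2_eq_square algebra_simps)
      then show ?thesis
        using nz False by (simp add: add_frac_eq)
    qed
    finally show ?thesis .
  qed
qed

lemma U_bilateral_sums:
  assumes "n \<ge> 1" and "norm z = 1"
  shows "(\<lambda>k. 1 / (of_int k ^ n + z ^ n)) bilateral_sums U n z"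
proof -
  define f where "f k = 1 / (of_int k ^ n + z ^ n)" for k
  have "summable (\<lambda>k. 4 * inverse (real (Suc k) ^ 2))"
    using inverse_power_summable[of 2, where ?'a = real]
    by (intro summable_mult) (subst summable_Suc_iff, simp)
  then have "summable (\<lambda>k. f (int (Suc k)) + f (- int (Suc k)))"
  \<comment> \<open>Starting at \<open>k = 1\<close> means starting at the pair of index
    \<open>Suc k = 2\<close>, as the bound requires; at index 1 a denominator can be arbitrarily
    small.\<close>
  proof (rule summable_comparison_test'[where N = 1])
    fix k :: nat
    assume "1 \<le> k"
    then show "norm (f (int (Suc k)) + f (- int (Suc k))) \<le> 4 * inverse (real (Suc k) ^ 2)"
      using norm_inverse_pair_le[of n "z ^ n" "real (Suc k)"] assms
      by (simp add: f_def norm_power divide_inverse)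
  qed
  \<comment> \<open>Once some limit exists, uniqueness identifies it with the definite description
    in \<open>U\<close>.\<close>
  from summable_imp_bilateral_sums[OF this] show ?thesis
    unfolding U_def using bilateral_suminf_eqI unfolding f_def by fastforce
qed

text \<open>Since \<open>1 / w = cnj w / (cmod w)\<^sup>2\<close>, this is the common denominator of
  the real and imaginary parts.\<close>

lemma cmod_of_real_add_cis_squared:
  "(cmod (of_real a + cis t))\<^sup>2 = a\<^sup>2 + 2 * a * cos t + 1"
proof -
  have "(cmod (of_real a + cis t))\<^sup>2 = a\<^sup>2 + 2 * a * cos t + ((cos t)\<^sup>2 + (sin t)\<^sup>2)"
    by (simp only: cmod_power2) (simp add: power2_eq_square algebra_simps)
  then show ?thesis
    by simp
qed

lemma Re_inverse_of_real_add_cis: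
  "Re (1 / (of_real a + cis t)) = (a + cos t) / (a\<^sup>2 + 2 * a * cos t + 1)"
  unfolding cmod_of_real_add_cis_squared[symmetric] by (simp add: Re_divide cmod_power2)

lemma Im_inverse_of_real_add_cis:
  "Im (1 / (of_real a + cis t)) = - (sin t / (a\<^sup>2 + 2 * a * cos t + 1))"
  unfolding cmod_of_real_add_cis_squared[symmetric] by (simp add: Im_divide cmod_power2)

theorem corollary2p2:
  fixes n :: nat and \<theta> :: real
  assumes "n \<ge> 1"
    and no_pole: "\<And>k::int. of_int k ^ n + cis \<theta> ^ n \<noteq> 0"
  shows "(\<lambda>k. 1 / (of_int k ^ n + cis \<theta> ^ n)) bilateral_sums U n (cis \<theta>)
    \<and> (\<lambda>k. (of_int k ^ n + cos (real n * \<theta>)) /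
          (of_int k ^ (2 * n) + 2 * of_int k ^ n * cos (real n * \<theta>) + 1))
        bilateral_sums Re (U n (cis \<theta>))
    \<and> (\<lambda>k. sin (real n * \<theta>) /
          (of_int k ^ (2 * n) + 2 * of_int k ^ n * cos (real n * \<theta>) + 1))
        bilateral_sums (- Im (U n (cis \<theta>)))
    \<and> (sin (real n * \<theta>) \<noteq> 0 \<longrightarrow>
        (\<lambda>k. of_int k ^ n /
          (of_int k ^ (2 * n) + 2 * of_int k ^ n * cos (real n * \<theta>) + 1))
        bilateral_sums (Re (U n (cis \<theta>)) + cot (real n * \<theta>) * Im (U n (cis \<theta>))))"
proof -
  define a :: "int \<Rightarrow> real" where "a k = of_int k ^ n" for k
  define t where "t = real n * \<theta>"
  define D where "D k = (a k)\<^sup>2 + 2 * a k * cos t + 1" for k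
  have term_eq: "1 / (of_int k ^ n + cis \<theta> ^ n) = 1 / (of_real (a k) + cis t)" for k
    by (simp add: a_def t_def Complex.DeMoivre)
  have D_eq: "of_int k ^ (2 * n) + 2 * of_int k ^ n * cos t + 1 = D k" for k
    by (simp add: D_def a_def power_mult[symmetric] mult.commute)
  have U_sums: "(\<lambda>k. 1 / (of_int k ^ n + cis \<theta> ^ n)) bilateral_sums U n (cis \<theta>)"
    using assms by (intro U_bilateral_sums) auto
  have Re_sums: "(\<lambda>k. (a k + cos t) / D k) bilateral_sums Re (U n (cis \<theta>))"
    using tendsto_Re[OF U_sums[unfolded bilateral_sums_def]]
    unfolding bilateral_sums_def term_eq Re_sum Re_inverse_of_real_add_cis D_def .
  have Im_sums: "(\<lambda>k. sin t / D k) bilateral_sums (- Im (U n (cis \<theta>)))"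
    using tendsto_minus[OF tendsto_Im[OF U_sums[unfolded bilateral_sums_def]]]
    unfolding bilateral_sums_def term_eq Im_sum Im_inverse_of_real_add_cis D_def
    by (simp add: sum_negf)
  have "(\<lambda>k. a k / D k) bilateral_sums
      (Re (U n (cis \<theta>)) + cot t * Im (U n (cis \<theta>)))" if "sin t \<noteq> 0"
  proof -
    \<comment> \<open>\<open>cot t * sin t = cos t\<close> cancels the cosine in the numerator; at
      \<open>sin t = 0\<close> this would fail, as \<open>cot t\<close> is then 0 by
      convention.\<close>
    have "(a k + cos t) / D k - cot t * (sin t / D k) = a k / D k" for k
      using that by (simp add: cot_def add_divide_distrib)
    then have "(\<Sum>k\<in>A. (a k + cos t) / D k) - cot t * (\<Sum>k\<in>A. sin t / D k) =
        (\<Sum>k\<in>A. a k / D k)" for A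
      by (simp only: sum_distrib_left flip: sum_subtractf)
    \<comment> \<open>\<open>Im_sums\<close> converges to \<open>- Im\<close>, so subtracting its
      multiple by \<open>cot t\<close> adds \<open>cot t * Im\<close>.\<close>
    with tendsto_diff[OF Re_sums[unfolded bilateral_sums_def]
        tendsto_mult_left[OF Im_sums[unfolded bilateral_sums_def], of "cot t"]]
    show ?thesis
      by (simp add: bilateral_sums_def)
  qed
  with U_sums Re_sums Im_sums show ?thesis
    unfolding t_def[symmetric] D_eq a_def by blast
qed

end
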